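(* Fix $n\in\{1,\dots,N\}$ and $h>0$ (the measured value of the channel gain $h_{n,1}$). Consider the optimization problem over $(M,t)$: $$\min_{M,\,t}\; Q_{n,1}(d_n,h;M,t)\quad\text{subject to}\quad T_3(n,M,t)\le T_{\text{th}},\quad M \text{ a positive integer},\quad 0<t\le\tau.$$ It is optimal to select a positive integer $M$ and $t\in(0,\tau]$ such that $T_3(n,M,t)=T_{\text{th}}$. That is, if $M^*$ is a positive integer and $t^*\in(0,\tau]$ with $T_3(n,M^*,t^* )=T_{\text{th}}$, then $$Q_{n,1}(d_n,h;M^*,t^* )\le Q_{n,1}(d_n,h;M',t')$$ for every positive integer $M'$ and every $t'\in(0,\tau]$ with $T_3(n,M',t')\le T_{\text{th}}$.
   Context: Constants: $N\ge1$ is an integer and $\mathcal N=\{1,\dots,N\}$; $l_i>0$ and $d_i\ge 0$ for $i\in\mathcal N$ (workload and input data size of sub-task $i$); $W>0$ (bandwidth); $\tau>0$ (channel coherence time); $T_{\text{th}}>0$ (deadline); $f_l>0$ and $f_e>0$ (local and edge CPU frequencies, with $f_l<f_e$). $p$ is a probability density on $(0,\infty)$, the common density of the i.i.d. channel gains. Total delay: $T_3(n,M,t)=\sum_{i=1}^{n-1}\frac{l_i}{f_l}+(M-1)\tau+t+\sum_{i=n}^{N}\frac{l_i}{f_e}$. Energy to send $d\ge0$ nats in a fading block of duration $s>0$ with channel gain $h>0$: $e(d,h,s)=\dfrac{\left(e^{d/(Ws)}-1\right)s}{h}$. For an integer $M\ge1$ (number of fading blocks) and $t\in(0,\tau]$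 (duration of the last block; the first $M-1$ blocks have duration $\tau$), the functions $Q_{n,m}(d,h;M,t)$ and $Q_{n,m}(d;M,t)$, for $m\in\{1,\dots,M\}$, $d\ge0$, $h>0$, are defined by backward recursion on $m$: $$Q_{n,M}(d,h;M,t)=e(d,h,t),$$ $$Q_{n,m}(d;M,t)=\int_0^\infty Q_{n,m}(d,x;M,t)\,p(x)\,dx\qquad (1\le m\le M),$$ $$Q_{n,m}(d,h;M,t)=\min_{0\le d'\le d}\Big(e(d',h,\tau)+Q_{n,m+1}(d-d';M,t)\Big)\qquad (1\le m\le M-1).$$ Values are taken in $[0,+\infty]$, and the minimum is read as an infimum if it is not attained. *)

theory Defs
  imports "HOL-Analysis.Analysis"
begin

definition total_delay ::
  "nat \<Rightarrow> (nat \<Rightarrow> real) \<Rightarrow> real \<Rightarrow> real \<Rightarrow> real \<Rightarrow> nat \<Rightarrow> nat \<Rightarrow> real \<Rightarrow> real" where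
  "total_delay N l f_l f_e \<tau> n M t =
     (\<Sum>i=1..<n. l i / f_l) + (real M - 1) * \<tau> + t + (\<Sum>i=n..N. l i / f_e)"

definition tx_energy :: "real \<Rightarrow> real \<Rightarrow> real \<Rightarrow> real \<Rightarrow> real" where
  "tx_energy W d h s = (exp (d / (W * s)) - 1) * s / h"

text \<open>
  A probability density on \<open>(0, \<infinity>)\<close>. Values of \<open>p\<close> outside \<open>(0, \<infinity>)\<close> are irrelevant here and
  in every integral below.
\<close>

definition gain_density :: "(real \<Rightarrow> real) \<Rightarrow> bool" where
  "gain_density p \<longleftrightarrow>
     set_borel_measurable lborel {0<..} p \<and> (\<forall>x>0. 0 \<le> p x) \<and>
     (\<integral>\<^sup>+x\<in>{0<..}. ennreal (p x) \<partial>lborel) = 1"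

text \<open>
  \<open>Q_gain p W \<tau> M t m d h\<close> is \<open>Q\<^sub>n\<^sub>,\<^sub>m(d, h; M, t)\<close>, and \<open>Q_mean p W \<tau> M t m d\<close> is
  \<open>Q\<^sub>n\<^sub>,\<^sub>m(d; M, t)\<close>. The recursion does not involve \<open>n\<close>, which is therefore not an argument.
  Only \<open>1 \<le> m \<le> M\<close>, \<open>d \<ge> 0\<close>, \<open>h > 0\<close> are meaningful; the value for \<open>m > M\<close> is a convention
  that makes the functions total.
\<close>

function
  Q_gain :: "(real \<Rightarrow> real) \<Rightarrow> real \<Rightarrow> real \<Rightarrow> nat \<Rightarrow> real \<Rightarrow> nat \<Rightarrow> real \<Rightarrow> real \<Rightarrow> ennreal"
and
  Q_mean :: "(real \<Rightarrow> real) \<Rightarrow> real \<Rightarrow> real \<Rightarrow> nat \<Rightarrow> real \<Rightarrow> nat \<Rightarrow> real \<Rightarrow> ennreal"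
where
  "Q_gain p W \<tau> M t m d h =
     (if m < M
      then (INF d'\<in>{0..d}. ennreal (tx_energy W d' h \<tau>) + Q_mean p W \<tau> M t (Suc m) (d - d'))
      else ennreal (tx_energy W d h t))"
| "Q_mean p W \<tau> M t m d =
     (\<integral>\<^sup>+x\<in>{0<..}. Q_gain p W \<tau> M t m d x * ennreal (p x) \<partial>lborel)"
  by pat_completeness auto
termination
  by (relation "Wellfounded.measure (\<lambda>a. case a of
        Inl (p, W, \<tau>, M, t, m, d, h) \<Rightarrow> 2 * (M - m)
      | Inr (p, W, \<tau>, M, t, m, d) \<Rightarrow> 2 * (M - m) + 1)") auto

declare Q_gain.simps [simp del] Q_mean.simps [simp del]

end

theory Submission
  imports Defs
begin

text \<open>
  Energy is non-increasing in the duration of a block, by convexity of the exponential, and nothing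
  is spent when no data is left. Since both last blocks have duration in \<open>(0, \<tau>]\<close>, a feasible
  \<open>(M', t')\<close> has either \<open>M' = M\<close> and \<open>t' \<le> t\<close>, or \<open>M' < M\<close>. In the first case the terminal cost
  with \<open>(M, t)\<close> is smaller. In the second, the schedule for \<open>(M, t)\<close> can send in block \<open>M'\<close>, now of
  duration \<open>\<tau> \<ge> t'\<close>, all the data remaining there, and idle afterwards.
\<close>

lemma tx_energy_antimono:
  assumes "0 < W" "0 \<le> d" "0 < h" "0 < s" "s \<le> s'"
  shows "tx_energy W d h s' \<le> tx_energy W d h s"
proof -
  define x where "x = d / (W * s)"
  \<comment> \<open>With this weight \<open>c * x\<close> is the exponent for the duration
    \<open>s'\<close>, and the chord of exp from 0 to \<open>x\<close> bounds exp there.\<close>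
  define c where "c = s / s'"
  have "0 < s'" using assms by simp
  have "0 \<le> c" "c \<le> 1" using assms \<open>0 < s'\<close> by (simp_all add: c_def)
  then have "exp ((1 - c) *\<^sub>R 0 + c *\<^sub>R x) \<le> (1 - c) * exp 0 + c * exp x"
    by (intro convex_onD[OF exp_convex]) auto
  then have "exp (c * x) - 1 \<le> c * (exp x - 1)"
    by (simp add: algebra_simps)
  then have "(exp (c * x) - 1) * s' \<le> c * (exp x - 1) * s'"
    using \<open>0 < s'\<close> by (intro mult_right_mono) auto
  moreover have "c * x = d / (W * s')" "c * (exp x - 1) * s' = (exp x - 1) * s"
    using assms \<open>0 < s'\<close> by (simp_all add: c_def x_def field_simps)
  ultimately have "(exp (d / (W * s')) - 1) * s' \<le> (exp (d / (W * s)) - 1) * s"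
    unfolding x_def by metis
  then show ?thesis
    unfolding tx_energy_def using \<open>0 < h\<close> by (intro divide_right_mono) auto
qed

text \<open>With no data the infimum ranges over the single split \<open>d' = 0\<close>, which costs
  nothing now and, inductively, nothing later.\<close>

lemma Q_gain_zero: "Q_gain p W \<tau> M t m 0 h = 0"
proof (induction "M - m" arbitrary: m h)
  case 0
  then show ?case by (simp add: Q_gain.simps tx_energy_def)
next
  case (Suc k)
  then have "\<And>x. Q_gain p W \<tau> M t (Suc m) 0 x = 0" and "m < M" by simp_all
  then show ?case
    by (simp add: Q_gain.simps[of _ _ _ _ _ m] Q_mean.simps tx_energy_def)
qed

lemma Q_mean_zero: "Q_mean p W \<tau> M t m 0 = 0"
  by (simp add: Q_mean.simps Q_gain_zero)

text \<open>Induction on the number of blocks left in the schedule \<open>(M', t')\<close>: until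
  its last block both recursions have the same form, so a difference can first arise at
  \<open>m = M'\<close>.\<close>

lemma Q_gain_le:
  assumes "0 < W" "0 < t'" "t' \<le> \<tau>"
    and order: "M' < M \<or> M' = M \<and> t' \<le> t"
    and "m \<le> M'" "0 \<le> d" "0 < h"
  shows "Q_gain p W \<tau> M t m d h \<le> Q_gain p W \<tau> M' t' m d h"
  using assms(5-)
proof (induction "M' - m" arbitrary: m d h)
  case 0
  then have "m = M'" by simp
  have last: "tx_energy W d h s \<le> tx_energy W d h t'" if "t' \<le> s" for s
    using tx_energy_antimono assms(1,2) 0 that by blast
  show ?case
  proof (cases "M' < M")
    case True
    \<comment> \<open>The split \<open>d' = d\<close> is one candidate in the infimum.\<close>
    have "Q_gain p W \<tau> M t m d h
        \<le> ennreal (tx_energy W d h \<tau>) + Q_mean p W \<tau> M t (Suc m) (d - d)"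
      unfolding Q_gain.simps[of _ _ _ M] using True \<open>m = M'\<close> \<open>0 \<le> d\<close>
      by (auto intro!: INF_lower2[of d])
    also have "\<dots> \<le> ennreal (tx_energy W d h t')"
      using last[OF \<open>t' \<le> \<tau>\<close>] by (simp add: Q_mean_zero ennreal_leI)
    finally show ?thesis
      using \<open>m = M'\<close> by (simp add: Q_gain.simps[of _ _ _ M' t'])
  next
    case False
    then show ?thesis
      using order \<open>m = M'\<close> last[of t] by (simp add: Q_gain.simps ennreal_leI)
  qed
next
  case (Suc k)
  then have "m < M'" "m < M" using order by auto
  \<comment> \<open>The induction hypothesis covers only gains \<open>x > 0\<close>; elsewhere the
    indicator makes both integrands 0.\<close>
  have "Q_mean p W \<tau> M t (Suc m) a \<le> Q_mean p W \<tau> M' t' (Suc m) a" if "0 \<le> a" for a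
    unfolding Q_mean.simps
    using Suc.hyps \<open>m < M'\<close> that
    by (intro nn_integral_mono) (auto simp: indicator_def intro!: mult_right_mono)
  then show ?case
    unfolding Q_gain.simps[of _ _ _ _ _ m] using \<open>m < M'\<close> \<open>m < M\<close>
    by (auto intro!: INF_superset_mono add_left_mono)
qed

text \<open>After cancelling common terms, \<open>M * \<tau> + t\<close> remains. As
  \<open>t\<close> and \<open>t'\<close> are remainders in \<open>(0, \<tau>]\<close>, its order is
  lexicographic in the pair.\<close>

lemma total_delay_le_cases:
  assumes "0 < \<tau>" "0 < t'" "t \<le> \<tau>"
    and "total_delay N l f_l f_e \<tau> n M' t' \<le> total_delay N l f_l f_e \<tau> n M t"
  shows "M' < M \<or> M' = M \<and> t' \<le> t"
proof -
  have le: "real M' * \<tau> + t' \<le> real M * \<tau> + t"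
    using assms(4) by (simp add: total_delay_def algebra_simps)
  have "M' \<le> M"
  proof (rule ccontr)
    \<comment> \<open>One extra block already costs \<open>\<tau> \<ge> t\<close>, and
      \<open>t' > 0\<close> makes the excess strict.\<close>
    assume "\<not> M' \<le> M"
    then have "(real M + 1) * \<tau> \<le> real M' * \<tau>"
      using \<open>0 < \<tau>\<close> by (intro mult_right_mono) auto
    then show False
      using le assms(2,3) by (simp add: algebra_simps)
  qed
  then show ?thesis using le by (cases "M' = M") auto
qed

theorem theorem2:
  fixes N n Mopt :: nat
    and l d :: "nat \<Rightarrow> real"
    and W \<tau> T_th f_l f_e h topt :: real
    and p :: "real \<Rightarrow> real"
  assumes "1 \<le> N"
    and "\<And>i. i \<in> {1..N} \<Longrightarrow> 0 < l i"
    and "\<And>i. i \<in> {1..N} \<Longrightarrow> 0 \<le> d i"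
    and "0 < W" and "0 < \<tau>" and "0 < T_th"
    and "0 < f_l" and "0 < f_e" and "f_l < f_e"
    and "gain_density p"
    and "n \<in> {1..N}"
    and "0 < h"
    and "1 \<le> Mopt" and "topt \<in> {0<..\<tau>}"
    and "total_delay N l f_l f_e \<tau> n Mopt topt = T_th"
  shows "\<forall>M' t'. 1 \<le> M' \<and> t' \<in> {0<..\<tau>} \<and> total_delay N l f_l f_e \<tau> n M' t' \<le> T_th \<longrightarrow>
           Q_gain p W \<tau> Mopt topt 1 (d n) h \<le> Q_gain p W \<tau> M' t' 1 (d n) h"
proof (intro allI impI, elim conjE)
  fix M' :: nat and t' :: real
  assume "1 \<le> M'" and t': "t' \<in> {0<..\<tau>}"
    and "total_delay N l f_l f_e \<tau> n M' t' \<le> T_th"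
  then have "M' < Mopt \<or> M' = Mopt \<and> t' \<le> topt"
    using assms by (intro total_delay_le_cases[of \<tau>]) auto
  then show "Q_gain p W \<tau> Mopt topt 1 (d n) h \<le> Q_gain p W \<tau> M' t' 1 (d n) h"
    using assms \<open>1 \<le> M'\<close> t' by (intro Q_gain_le) auto
qed

end
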